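(* Let $M$ be a deterministic Markov decision process with nonempty state space $\mathcal{X}$, nonempty control space $\mathcal{U}$, dynamics $f:\mathcal{X}\times\mathcal{U}\to\mathcal{X}$ and discount factor $\gamma\in[0,1)$, and let $\mathcal{X}_{\mathrm{unsafe}}\subseteq\mathcal{X}$ be a specified set of unsafe states. Suppose that (a) early termination is employed with termination condition $\mathcal{X}_{\mathrm{unsafe}}$; (b) the reward has the safety-preserving structure, i.e. $r(x,u,x')=0$ if $x'\in\mathcal{X}_{\mathrm{unsafe}}$ and $r(x,u,x')=1$ otherwise; and (c) there is an upper bound $H\in\mathbb{N}$ on irrecoverability, i.e. every $x\in\mathcal{X}_{\mathrm{irrec}}$ is $k$-irrecoverable for some $k\in\mathbb{N}$ and the minimal such $k$, denoted $k_x$, satisfies $k_x\le H$. Let $V^*$ be the optimal value function. Then for every $R\in\left(\frac{1-\gamma^H}{1-\gamma},\frac{1}{1-\gamma}\right]$ and every $\alpha\in(0,1]$, the function $h=V^*-R$ is a control barrier function against $\mathcal{X}_{\mathrm{unsafe}}$ (with parameter $\alpha$).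
   Context: Safe and irrecoverable states: a state $x$ is indefinitely safe if it belongs to some set $S\subseteq\mathcal{X}\setminus\mathcal{X}_{\mathrm{unsafe}}$ for which there is a controller $\pi:\mathcal{X}\to\mathcal{U}$ such that $S$ is forward-invariant under $f_\pi(x)=f(x,\pi(x))$ (i.e. $x\in S$ implies $f_\pi(x)\in S$). $\mathcal{X}_{\mathrm{safe}}$ is the set of all indefinitely safe states, and $\mathcal{X}_{\mathrm{irrec}}=\mathcal{X}\setminus(\mathcal{X}_{\mathrm{unsafe}}\cup\mathcal{X}_{\mathrm{safe}})$ is the set of irrecoverable states. A state $x$ is $k$-irrecoverable if, for every choice of controls, the trajectory started at $x$ enters $\mathcal{X}_{\mathrm{unsafe}}$ within $k$ timesteps. Value function: early termination means that the episode stops, and no further reward is collected, as soon as a state in $\mathcal{X}_{\mathrm{unsafe}}$ is reached. Thus $V^*(x)=0$ for $x\in\mathcal{X}_{\mathrm{unsafe}}$, and for $x\notin\mathcal{X}_{\mathrm{unsafe}}$, $V^*(x)$ is the supremum over control sequences $(u_t)_{t\ge 0}$ of the discounted return $\sum_{t} \gamma^t r(x_t,u_t,x_{t+1})$, where $x_0=x$, $x_{t+1}=f(x_t,u_t)$, and the sum runs over all $t\ge 0$ such that none of $x_0,\dots,x_t$ lies in $\mathcal{X}_{\mathrm{unsafe}}$. Control barrier function: for $\alpha\in(0,1]$, a function $h:\mathcal{X}\to\mathbb{R}$ is a (discrete-time) control barrier function against $\mathcal{X}_{\mathrm{unsafe}}$ with parameter $\alpha$ if (i) $h(x)<0$ for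 all $x\in\mathcal{X}_{\mathrm{unsafe}}$, and (ii) for all $x\in\mathcal{X}$ with $h(x)\ge 0$, $\sup_{u\in\mathcal{U}} h(f(x,u))\ge(1-\alpha)h(x)$. *)

theory Defs
  imports Complex_Main "HOL-Library.Extended_Real"
begin

text \<open>
  The state space and the control space are the types \<open>'x\<close> and \<open>'u\<close>, which are nonempty as
  all HOL types are.  The dynamics is the curried function \<open>f\<close>, the set of unsafe states is \<open>A\<close>.
\<close>

definition forward_invariant :: "('x \<Rightarrow> 'x) \<Rightarrow> 'x set \<Rightarrow> bool" where
  "forward_invariant g S \<longleftrightarrow> (\<forall>x\<in>S. g x \<in> S)"

definition safe_states :: "('x \<Rightarrow> 'u \<Rightarrow> 'x) \<Rightarrow> 'x set \<Rightarrow> 'x set" where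
  "safe_states f A =
     {x. \<exists>S. x \<in> S \<and> S \<subseteq> - A \<and> (\<exists>\<pi>. forward_invariant (\<lambda>y. f y (\<pi> y)) S)}"

definition irrecoverable_states :: "('x \<Rightarrow> 'u \<Rightarrow> 'x) \<Rightarrow> 'x set \<Rightarrow> 'x set" where
  "irrecoverable_states f A = - (A \<union> safe_states f A)"

primrec trajectory :: "('x \<Rightarrow> 'u \<Rightarrow> 'x) \<Rightarrow> 'x \<Rightarrow> (nat \<Rightarrow> 'u) \<Rightarrow> nat \<Rightarrow> 'x" where
  "trajectory f x u 0 = x"
| "trajectory f x u (Suc t) = f (trajectory f x u t) (u t)"

definition k_irrecoverable :: "('x \<Rightarrow> 'u \<Rightarrow> 'x) \<Rightarrow> 'x set \<Rightarrow> nat \<Rightarrow> 'x \<Rightarrow> bool" where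
  "k_irrecoverable f A k x \<longleftrightarrow> (\<forall>u. \<exists>t\<le>k. trajectory f x u t \<in> A)"

text \<open>Only meaningful if \<open>x\<close> is \<open>k\<close>-irrecoverable for some \<open>k\<close>.\<close>

definition irrecoverability_time :: "('x \<Rightarrow> 'u \<Rightarrow> 'x) \<Rightarrow> 'x set \<Rightarrow> 'x \<Rightarrow> nat" where
  "irrecoverability_time f A x = (LEAST k. k_irrecoverable f A k x)"

definition irrecoverability_bound :: "('x \<Rightarrow> 'u \<Rightarrow> 'x) \<Rightarrow> 'x set \<Rightarrow> nat \<Rightarrow> bool" where
  "irrecoverability_bound f A H \<longleftrightarrow>
     (\<forall>x\<in>irrecoverable_states f A.
        (\<exists>k. k_irrecoverable f A k x) \<and> irrecoverability_time f A x \<le> H)"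

text \<open>
  Early termination: the reward of step \<open>t\<close> counts only if none of \<open>x\<^sub>0, \<dots>, x\<^sub>t\<close> is unsafe.
\<close>

definition discounted_return ::
  "('x \<Rightarrow> 'u \<Rightarrow> 'x) \<Rightarrow> ('x \<Rightarrow> 'u \<Rightarrow> 'x \<Rightarrow> real) \<Rightarrow> real \<Rightarrow> 'x set \<Rightarrow> 'x \<Rightarrow> (nat \<Rightarrow> 'u) \<Rightarrow> real"
where
  "discounted_return f r \<gamma> A x u =
     (\<Sum>t. if \<forall>s\<le>t. trajectory f x u s \<notin> A
          then \<gamma> ^ t * r (trajectory f x u t) (u t) (trajectory f x u (Suc t)) else 0)"

text \<open>
  The series and the real supremum are the genuine ones for bounded rewards and
  \<open>0 \<le> \<gamma> < 1\<close>; otherwise \<open>suminf\<close> and \<open>Sup\<close> may return unspecified values.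
\<close>

definition optimal_value ::
  "('x \<Rightarrow> 'u \<Rightarrow> 'x) \<Rightarrow> ('x \<Rightarrow> 'u \<Rightarrow> 'x \<Rightarrow> real) \<Rightarrow> real \<Rightarrow> 'x set \<Rightarrow> 'x \<Rightarrow> real"
where
  "optimal_value f r \<gamma> A x = (if x \<in> A then 0 else (SUP u. discounted_return f r \<gamma> A x u))"

definition safety_preserving_reward :: "('x \<Rightarrow> 'u \<Rightarrow> 'x \<Rightarrow> real) \<Rightarrow> 'x set \<Rightarrow> bool" where
  "safety_preserving_reward r A \<longleftrightarrow> (\<forall>x u x'. r x u x' = (if x' \<in> A then 0 else 1))"

text \<open>
  The supremum over controls is taken in the extended reals, since \<open>h\<close> need not be bounded.
\<close>

definition control_barrier_function ::
  "('x \<Rightarrow> 'u \<Rightarrow> 'x) \<Rightarrow> 'x set \<Rightarrow> real \<Rightarrow> ('x \<Rightarrow> real) \<Rightarrow> bool"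
where
  "control_barrier_function f A \<alpha> h \<longleftrightarrow>
     (\<forall>x\<in>A. h x < 0) \<and>
     (\<forall>x. h x \<ge> 0 \<longrightarrow> (SUP u. ereal (h (f x u))) \<ge> ereal ((1 - \<alpha>) * h x))"

end

theory Submission
  imports Defs
begin

text \<open>
  An unsafe state has value 0, and from an irrecoverable state the reward stops before step \<open>H\<close>,
  so its value is at most \<open>(1 - \<gamma>^H) / (1 - \<gamma>) < R\<close>.  Hence \<open>h \<ge> 0\<close> only at safe states.  From a safe
  state some control leads to another safe state, where \<open>V\<^sup>*\<close> attains its global maximum
  \<open>1 / (1 - \<gamma>)\<close>, so \<open>h\<close> does not decrease.
\<close>

text \<open>\<open>P\<close> stands for the survival condition of early termination. The two bounds
  let every return be compared termwise with the geometric series.\<close>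

lemma safety_reward_term_bounds:
  assumes "0 \<le> \<gamma>" and "safety_preserving_reward r A"
  shows "0 \<le> (if P then \<gamma> ^ t * r x u x' else 0)"
    and "(if P then \<gamma> ^ t * r x u x' else 0) \<le> \<gamma> ^ t"
  using assms by (auto simp: safety_preserving_reward_def)

lemma discounted_return_le:
  assumes "0 \<le> \<gamma>" "\<gamma> < 1" "safety_preserving_reward r A"
  shows "discounted_return f r \<gamma> A x u \<le> 1 / (1 - \<gamma>)"
proof -
  have geo: "summable (\<lambda>t. \<gamma> ^ t)"
    using assms by simp
  have "discounted_return f r \<gamma> A x u \<le> (\<Sum>t. \<gamma> ^ t)"
    unfolding discounted_return_def
    using safety_reward_term_bounds[OF assms(1,3)]
    by (intro suminf_le summable_comparison_test'[OF geo] geo) auto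
  then show ?thesis
    using assms by (simp add: suminf_geometric)
qed

lemma discounted_return_eq_of_avoids:
  assumes "0 \<le> \<gamma>" "\<gamma> < 1" "safety_preserving_reward r A"
    and "\<And>t. trajectory f x u t \<notin> A"
  shows "discounted_return f r \<gamma> A x u = 1 / (1 - \<gamma>)"
proof -
  \<comment> \<open>The reward of step \<open>t\<close> inspects the successor state, hence
    avoidance at \<open>Suc t\<close>.\<close>
  have "r (trajectory f x u t) (u t) (trajectory f x u (Suc t)) = 1" for t
    using assms(3) assms(4)[of "Suc t"] unfolding safety_preserving_reward_def by simp
  then show ?thesis
    using assms unfolding discounted_return_def by (simp add: suminf_geometric)
qed

text \<open>One visit to \<open>A\<close> at time \<open>t\<close> falsifies the survival condition
  of every step from \<open>t\<close> on, so only steps below \<open>H\<close> can contribute, each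
  by at most its discount factor.\<close>

lemma discounted_return_le_of_hits:
  assumes "0 \<le> \<gamma>" "\<gamma> < 1" "safety_preserving_reward r A"
    and "t \<le> H" "trajectory f x u t \<in> A"
  shows "discounted_return f r \<gamma> A x u \<le> (1 - \<gamma> ^ H) / (1 - \<gamma>)"
proof -
  let ?term = "\<lambda>t. if \<forall>s\<le>t. trajectory f x u s \<notin> A
    then \<gamma> ^ t * r (trajectory f x u t) (u t) (trajectory f x u (Suc t)) else 0"
  have "?term s = 0" if "s \<notin> {..<H}" for s
  proof -
    have "t \<le> s"
      using assms(4) that by simp
    then show ?thesis
      using assms(5) by auto
  qed
  then have "discounted_return f r \<gamma> A x u = (\<Sum>s<H. ?term s)"
    unfolding discounted_return_def by (intro suminf_finite) auto
  also have "\<dots> \<le> (\<Sum>s<H. \<gamma> ^ s)"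
    by (intro sum_mono safety_reward_term_bounds(2)[OF assms(1,3)])
  also have "\<dots> = (1 - \<gamma> ^ H) / (1 - \<gamma>)"
    using assms(2) by (simp add: sum_gp_strict)
  finally show ?thesis .
qed

lemma optimal_value_le:
  assumes "0 \<le> \<gamma>" "\<gamma> < 1" "safety_preserving_reward r A"
  shows "optimal_value f r \<gamma> A x \<le> 1 / (1 - \<gamma>)"
  using assms
  by (auto simp: optimal_value_def intro!: cSUP_least discounted_return_le)

text \<open>Turns a feedback controller into an open-loop control sequence, the form over which
  returns are taken. The same \<open>S\<close> and \<open>\<pi>\<close> certify the first successor
  as safe.\<close>

lemma safe_statesE:
  fixes f :: "'x \<Rightarrow> 'u \<Rightarrow> 'x"
  assumes "x \<in> safe_states f A"
  obtains u where "\<And>t. trajectory f x u t \<notin> A" and "f x (u 0) \<in> safe_states f A"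
proof -
  obtain S and \<pi> :: "'x \<Rightarrow> 'u" where S: "x \<in> S" "S \<subseteq> - A" and inv: "\<forall>y\<in>S. f y (\<pi> y) \<in> S"
    using assms unfolding safe_states_def forward_invariant_def by blast
  \<comment> \<open>Replays \<open>\<pi>\<close> along its own closed-loop orbit, so that the
    trajectory under \<open>?u\<close> is that orbit.\<close>
  let ?u = "\<lambda>t. \<pi> (((\<lambda>y. f y (\<pi> y)) ^^ t) x)"
  have traj: "trajectory f x ?u t = ((\<lambda>y. f y (\<pi> y)) ^^ t) x" for t
    by (induction t) auto
  have "((\<lambda>y. f y (\<pi> y)) ^^ t) x \<in> S" for t
    using S(1) inv by (induction t) auto
  then have "trajectory f x ?u t \<notin> A" for t
    using traj S(2) by auto
  moreover have "f x (?u 0) \<in> safe_states f A"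
    using S inv unfolding safe_states_def forward_invariant_def by auto
  ultimately show thesis
    by (rule that)
qed

lemma optimal_value_safe:
  assumes "0 \<le> \<gamma>" "\<gamma> < 1" "safety_preserving_reward r A"
    and "x \<in> safe_states f A"
  shows "optimal_value f r \<gamma> A x = 1 / (1 - \<gamma>)"
proof (rule antisym[OF optimal_value_le[OF assms(1-3)]])
  obtain u where u: "\<And>t. trajectory f x u t \<notin> A"
    using safe_statesE[OF assms(4)] by metis
  \<comment> \<open>A real supremum is known to dominate its members only when the set is bounded
    above.\<close>
  have "bdd_above (range (discounted_return f r \<gamma> A x))"
    using discounted_return_le[OF assms(1-3)] by (auto intro!: bdd_aboveI)
  then have "discounted_return f r \<gamma> A x u \<le> (SUP u. discounted_return f r \<gamma> A x u)"
    by (intro cSUP_upper) auto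
  then show "1 / (1 - \<gamma>) \<le> optimal_value f r \<gamma> A x"
    \<comment> \<open>Time 0 gives \<open>x \<notin> A\<close>, which selects the supremum branch of
      \<open>optimal_value\<close>.\<close>
    using u[of 0] discounted_return_eq_of_avoids[OF assms(1-3) u] by (simp add: optimal_value_def)
qed

text \<open>Some \<open>k\<close> exists, so the \<open>LEAST\<close> in
  \<open>irrecoverability_time\<close> is attained. The hitting time \<open>t\<close> may depend on
  \<open>u\<close>; only the bound \<open>H\<close> is uniform, which is what a supremum over
  \<open>u\<close> requires.\<close>

lemma irrecoverability_bound_hits:
  assumes "irrecoverability_bound f A H" and "x \<in> irrecoverable_states f A"
  obtains t where "t \<le> H" and "trajectory f x u t \<in> A"
proof -
  have "k_irrecoverable f A (irrecoverability_time f A x) x"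
    using assms unfolding irrecoverability_bound_def irrecoverability_time_def
    by (metis LeastI_ex)
  moreover have "irrecoverability_time f A x \<le> H"
    using assms by (auto simp: irrecoverability_bound_def)
  ultimately show thesis
    unfolding k_irrecoverable_def by (meson le_trans that)
qed

lemma optimal_value_irrecoverable_le:
  assumes "0 \<le> \<gamma>" "\<gamma> < 1" "safety_preserving_reward r A"
    and "irrecoverability_bound f A H" and "x \<in> irrecoverable_states f A"
  shows "optimal_value f r \<gamma> A x \<le> (1 - \<gamma> ^ H) / (1 - \<gamma>)"
proof -
  have "discounted_return f r \<gamma> A x u \<le> (1 - \<gamma> ^ H) / (1 - \<gamma>)" for u
    using irrecoverability_bound_hits[OF assms(4,5), of u]
      discounted_return_le_of_hits[OF assms(1-3)] by metis
  moreover have "x \<notin> A"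
    using assms(5) by (simp add: irrecoverable_states_def)
  ultimately show ?thesis
    by (auto simp: optimal_value_def intro!: cSUP_least)
qed

theorem theorem3p1:
  fixes f :: "'x \<Rightarrow> 'u \<Rightarrow> 'x"
    and r :: "'x \<Rightarrow> 'u \<Rightarrow> 'x \<Rightarrow> real"
    and \<gamma> :: real
    and X_unsafe :: "'x set"
    and H :: nat
  assumes "0 \<le> \<gamma>" and "\<gamma> < 1"
    and "safety_preserving_reward r X_unsafe"
    and "irrecoverability_bound f X_unsafe H"
  shows "\<forall>R \<in> {(1 - \<gamma> ^ H) / (1 - \<gamma>) <.. 1 / (1 - \<gamma>)}. \<forall>\<alpha> \<in> {0<..1}.
           control_barrier_function f X_unsafe \<alpha> (\<lambda>x. optimal_value f r \<gamma> X_unsafe x - R)"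
proof (intro ballI)
  fix R \<alpha> :: real
  assume "R \<in> {(1 - \<gamma> ^ H) / (1 - \<gamma>) <.. 1 / (1 - \<gamma>)}" and "\<alpha> \<in> {0<..1}"
  then have R: "(1 - \<gamma> ^ H) / (1 - \<gamma>) < R" and \<alpha>: "0 < \<alpha>" "\<alpha> \<le> 1"
    by auto
  let ?V = "optimal_value f r \<gamma> X_unsafe"
  \<comment> \<open>This makes \<open>R\<close> positive, hence \<open>h\<close> negative on unsafe
    states, where the value is 0.\<close>
  have "0 \<le> (1 - \<gamma> ^ H) / (1 - \<gamma>)"
    using assms(1,2) by (simp add: power_le_one)
  with R have "0 < R"
    by linarith
  have unsafe: "?V x - R < 0" if "x \<in> X_unsafe" for x
    using that \<open>0 < R\<close> by (simp add: optimal_value_def)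
  have "ereal ((1 - \<alpha>) * (?V x - R)) \<le> (SUP u. ereal (?V (f x u) - R))" if h: "0 \<le> ?V x - R" for x
  proof -
    have "x \<notin> irrecoverable_states f X_unsafe"
      using optimal_value_irrecoverable_le[OF assms] h R by fastforce
    then have "x \<in> safe_states f X_unsafe"
      using unsafe[of x] h by (auto simp: irrecoverable_states_def)
    then obtain u where u: "f x u \<in> safe_states f X_unsafe"
      by (metis safe_statesE)
    \<comment> \<open>As \<open>1 - \<alpha>\<close> lies in [0,1) and \<open>h\<close> is
      nonnegative at \<open>x\<close>, the factor can only shrink it.\<close>
    have "(1 - \<alpha>) * (?V x - R) \<le> ?V x - R"
      using \<alpha> h by (intro mult_left_le_one_le) auto
    also have "\<dots> \<le> ?V (f x u) - R"
      using optimal_value_le[OF assms(1-3)] optimal_value_safe[OF assms(1-3) u] by simp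
    finally show ?thesis
      by (intro SUP_upper2[of u]) auto
  qed
  with unsafe show "control_barrier_function f X_unsafe \<alpha> (\<lambda>x. ?V x - R)"
    by (simp add: control_barrier_function_def)
qed

end
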